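(* Let $X\in\{x_1,x_2\}$ and $Y\in\{y_1,y_2\}$ be dichotomous, let $\mathbf{S},\mathbf{W}$ be sets of discrete intermediate variables and $\mathbf{Z},\mathbf{R}$ sets of discrete covariates such that the identification conditions (stated in the context) hold for $(\mathbf{S},\mathbf{Z})$ and for $(\mathbf{W},\mathbf{R})$, and suppose $\mathbf{U}=\mathbf{S}\cup\mathbf{Z}$ and $\mathbf{T}=\mathbf{W}\cup\mathbf{R}$ are non-empty. Let $y\in\{y_1,y_2\}$. With the quantities $\operatorname{NDE}$, $\operatorname{NIE}$ and the asymptotic variances $\operatorname{a.var}$ as defined in the context: (I) Suppose $\operatorname{NDE}^{S}_y(x_1,x_2;\mathbf{Z})=\operatorname{NDE}^{S,W}_y(x_1,x_2;\mathbf{Z},\mathbf{R})$, $\operatorname{NIE}^{S}_y(x_1,x_2;\mathbf{Z})=\operatorname{NIE}^{S,W}_y(x_1,x_2;\mathbf{Z},\mathbf{R})$, and $Y\perp\!\!\!\perp\mathbf{T}\mid\{X\}\cup\mathbf{U}$. Then $$\operatorname{a.var}\{\widehat{\operatorname{NDE}}^{S}_y(x_1,x_2;\mathbf{Z})\}\le\operatorname{a.var}\{\widehat{\operatorname{NDE}}^{S,W}_y(x_1,x_2;\mathbf{Z},\mathbf{R})\}$$ and $$\operatorname{a.var}\{\widehat{\operatorname{NIE}}^{S}_y(x_1,x_2;\mathbf{Z})\}\le\operatorname{a.var}\{\widehat{\operatorname{NIE}}^{S,W}_y(x_1,x_2;\mathbf{Z},\mathbf{R})\}.$$ (II) Suppose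 $\operatorname{NDE}^{W}_y(x_1,x_2;\mathbf{R})=\operatorname{NDE}^{S,W}_y(x_1,x_2;\mathbf{Z},\mathbf{R})$, $\operatorname{NIE}^{W}_y(x_1,x_2;\mathbf{R})=\operatorname{NIE}^{S,W}_y(x_1,x_2;\mathbf{Z},\mathbf{R})$, and $X\perp\!\!\!\perp\mathbf{U}\mid\mathbf{T}$. (II.a) If for every value $t$ of $\mathbf{T}$ both $$1+n_{x_2}\operatorname{pr}(t|x_2)\le n_{x_1}\operatorname{pr}(t|x_1)$$ and $$\operatorname{cov}(t):=\sum_{u}\operatorname{pr}(y_1|x_1,t,u)\operatorname{pr}(y_1|x_2,t,u)\operatorname{pr}(u|t)-\operatorname{pr}(y_1|x_1,t)\operatorname{pr}(y_1|x_2,t)\le 0$$ hold, then $$\operatorname{a.var}\{\widehat{\operatorname{NDE}}^{W}_y(x_1,x_2;\mathbf{R})\}\le\operatorname{a.var}\{\widehat{\operatorname{NDE}}^{S,W}_y(x_1,x_2;\mathbf{Z},\mathbf{R})\}.$$ (II.b) If $1+n_{x_2}\operatorname{pr}(t|x_2)\le n_{x_1}\operatorname{pr}(t|x_1)$ holds for every value $t$ of $\mathbf{T}$, then $$\operatorname{a.var}\{\widehat{\operatorname{NIE}}^{W}_y(x_1,x_2;\mathbf{R})\}\le\operatorname{a.var}\{\widehat{\operatorname{NIE}}^{S,W}_y(x_1,x_2;\mathbf{Z},\mathbf{R})\}.$$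
   Context: Notation. $\operatorname{pr}(\cdot\mid\cdot)$ denotes (conditional) probabilities of the joint distribution of $(X,Y,\mathbf{S},\mathbf{W},\mathbf{Z},\mathbf{R})$, e.g. $\operatorname{pr}(y|x,u)=\operatorname{pr}(Y=y|X=x,\mathbf{U}=u)$; $\mathbf{A}\perp\!\!\!\perp\mathbf{B}\mid\mathbf{C}$ denotes conditional independence under this distribution. All variables take finitely many values. For a set $\mathbf{V}$ of variables ($\mathbf{U}$, $\mathbf{T}$ or $\mathbf{U}\cup\mathbf{T}$), sums over $v$ and "every value $v$" range over the values with positive probability, and for these $\operatorname{pr}(v|x_1)>0$ and $\operatorname{pr}(v|x_2)>0$ are assumed. Identification conditions for a pair $(\mathbf{S},\mathbf{Z})$. Let $Y_{x,s}$ be the potential response of $Y$ had $X$ and $\mathbf{S}$ been set to $x$ and $s$, and $\mathbf{S}_{x'}$ the potential value of $\mathbf{S}$ had $X$ been set to $x'$; consistency is assumed ($X=x\Rightarrow \mathbf{S}_x=\mathbf{S}$; $X=x,\mathbf{S}=s\Rightarrow Y_{x,s}=Y$). The conditions are, for $x,x'\in\{x_1,x_2\}$ and all $s$: (a) $\mathbf{S}\perp\!\!\!\perp Y_{x,s}\mid\{X\}\cup\mathbf{Z}$ and $Y_{x,s}\perp\!\!\!\perp\mathbf{S}_{x'}\mid\mathbf{Z}$; (b) $X\perp\!\!\!\perp\{Y_{x,s}\}\cup\mathbf{S}_{x'}\cup\mathbf{Z}$ (randomized treatment). Analogously for $(\mathbf{W},\mathbf{R})$. Natural direct and indirect effects.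 Under these conditions the effects are given, with $\mathbf{V}=\mathbf{S}\cup\mathbf{Z}$, by $$\operatorname{NDE}^{S}_y(x_1,x_2;\mathbf{Z})=\sum_v\{\operatorname{pr}(y|x_1,v)-\operatorname{pr}(y|x_2,v)\}\operatorname{pr}(v|x_2),$$ $$\operatorname{NIE}^{S}_y(x_1,x_2;\mathbf{Z})=\sum_v\operatorname{pr}(y|x_1,v)\{\operatorname{pr}(v|x_1)-\operatorname{pr}(v|x_2)\}.$$ $\operatorname{NDE}^{W}_y(x_1,x_2;\mathbf{R})$, $\operatorname{NIE}^{W}_y(x_1,x_2;\mathbf{R})$ are given by the same formulas with $\mathbf{V}=\mathbf{T}=\mathbf{W}\cup\mathbf{R}$, and $\operatorname{NDE}^{S,W}_y(x_1,x_2;\mathbf{Z},\mathbf{R})$, $\operatorname{NIE}^{S,W}_y(x_1,x_2;\mathbf{Z},\mathbf{R})$ with $\mathbf{V}=\mathbf{U}\cup\mathbf{T}$. Estimators. There are $n_{x_i}\ge1$ subjects with $X=x_i$ ($i=1,2$); the counts $n_{x_i,y_j,v}$ over cells $(y_j,v)$ are multinomial with size $n_{x_i}$ and cell probabilities $\operatorname{pr}(y_j,v|x_i)$; $n_{x_i,v}=\sum_j n_{x_i,y_j,v}$. The estimators $\widehat{\operatorname{NDE}}$, $\widehat{\operatorname{NIE}}$ are obtained by substituting $n_{x,y,v}/n_x$ for $\operatorname{pr}(y,v|x)$ in the formulas above. Asymptotic variances. $\operatorname{a.var}$ denotes the variance of the estimator after applying the delta-method approximation $E(1/n_{x,v})\simeq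 1/(n_x\operatorname{pr}(v|x))$. Explicitly, put $$e_v=\frac{n_{x_2}^2}{n_{x_1}\operatorname{pr}(v|x_1)}\left(\frac{\operatorname{pr}(v|x_2)(1-\operatorname{pr}(v|x_2))}{n_{x_2}}+\operatorname{pr}(v|x_2)^2\right)$$ (the approximation of $E(n_{x_2,v}^2/n_{x_1,v})$). Then, for each of the three choices of $\mathbf{V}$, with $\operatorname{NDE}$ the corresponding natural direct effect, $$\operatorname{a.var}\{\widehat{\operatorname{NDE}}\}=\sum_v\{\operatorname{pr}(y|x_1,v)-\operatorname{pr}(y|x_2,v)\}^2\frac{\operatorname{pr}(v|x_2)}{n_{x_2}}-\frac{\operatorname{NDE}^2}{n_{x_2}}+\sum_v\frac{\operatorname{pr}(y|x_1,v)(1-\operatorname{pr}(y|x_1,v))}{n_{x_2}^2}e_v+\sum_v\frac{\operatorname{pr}(y|x_2,v)(1-\operatorname{pr}(y|x_2,v))}{n_{x_2}}\operatorname{pr}(v|x_2),$$ $$\operatorname{a.var}\{\widehat{\operatorname{NIE}}\}=\sum_v\frac{\operatorname{pr}(y|x_1,v)(1-\operatorname{pr}(y|x_1,v))}{n_{x_2}^2}e_v-2\sum_v\operatorname{pr}(y|x_1,v)(1-\operatorname{pr}(y|x_1,v))\frac{\operatorname{pr}(v|x_2)}{n_{x_1}}+\frac{\operatorname{pr}(y|x_1)(1-\operatorname{pr}(y|x_1))}{n_{x_1}}+\frac{1}{n_{x_2}}\left(\sum_v\operatorname{pr}(y|x_1,v)^2\operatorname{pr}(v|x_2)-\Bigl(\sum_v\operatorname{pr}(y|x_1,v)\operatorname{pr}(v|x_2)\Bigr)^2\right).$$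 In $\operatorname{cov}(t)$ the sum runs over values $u$ of $\mathbf{U}$ with $\operatorname{pr}(u|t)>0$. *)

theory Defs
  imports "HOL-Probability.Probability"
begin

text \<open>
  The joint distribution lives on a probability space \<open>M\<close>.  Individual intermediate variables and
  covariates are members \<open>F i\<close> of one family of random variables; a \<^emph>\<open>set of variables\<close> is a set of
  indices, so that unions (also of overlapping sets) are unions of index sets.  The joint value of
  such a set is an extensional function.  Random variables with finitely many values are rendered
  by \<^const>\<open>simple_function\<close>.
\<close>

definition joint :: "('i \<Rightarrow> 'a \<Rightarrow> 'v) \<Rightarrow> 'i set \<Rightarrow> 'a \<Rightarrow> ('i \<Rightarrow> 'v)" where
  "joint F A = (\<lambda>\<omega>. \<lambda>i\<in>A. F i \<omega>)"

definition pos_values :: "'a measure \<Rightarrow> ('a \<Rightarrow> 'b) \<Rightarrow> 'b set" where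
  "pos_values M V = {v. 0 < \<P>(\<omega> in M. V \<omega> = v)}"

text \<open>
  The next two notions are stated through point masses and are meant for variables with finitely
  many values only.  The library's \<open>indep_var\<close> is not applicable, as it requires both variables to
  have the same value type.
\<close>

definition discrete_indep :: "'a measure \<Rightarrow> ('a \<Rightarrow> 'b) \<Rightarrow> ('a \<Rightarrow> 'c) \<Rightarrow> bool" where
  "discrete_indep M A B \<longleftrightarrow>
     (\<forall>a b. \<P>(\<omega> in M. A \<omega> = a \<and> B \<omega> = b) = \<P>(\<omega> in M. A \<omega> = a) * \<P>(\<omega> in M. B \<omega> = b))"

definition discrete_cond_indep ::
    "'a measure \<Rightarrow> ('a \<Rightarrow> 'b) \<Rightarrow> ('a \<Rightarrow> 'c) \<Rightarrow> ('a \<Rightarrow> 'd) \<Rightarrow> bool" where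
  "discrete_cond_indep M A B C \<longleftrightarrow>
     (\<forall>a b. \<forall>c\<in>pos_values M C.
        \<P>(\<omega> in M. A \<omega> = a \<and> B \<omega> = b \<bar> C \<omega> = c) =
        \<P>(\<omega> in M. A \<omega> = a \<bar> C \<omega> = c) * \<P>(\<omega> in M. B \<omega> = b \<bar> C \<omega> = c))"

text \<open>
  \<open>Yp x s\<close> is the potential response had \<open>X\<close> and the variables in \<open>S\<close> been set to \<open>x\<close> and \<open>s\<close>;
  \<open>Fp x' i\<close> is the potential value of the variable \<open>i \<in> S\<close> had \<open>X\<close> been set to \<open>x'\<close>.
\<close>

definition identification_conditions ::
    "'a measure \<Rightarrow> ('a \<Rightarrow> 'x) \<Rightarrow> ('a \<Rightarrow> 'y) \<Rightarrow> 'x \<Rightarrow> 'x \<Rightarrow> ('i \<Rightarrow> 'a \<Rightarrow> 'v) \<Rightarrow> 'i set \<Rightarrow> 'i set \<Rightarrow>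
     ('x \<Rightarrow> ('i \<Rightarrow> 'v) \<Rightarrow> 'a \<Rightarrow> 'y) \<Rightarrow> ('x \<Rightarrow> 'i \<Rightarrow> 'a \<Rightarrow> 'v) \<Rightarrow> bool" where
  "identification_conditions M X Y x1 x2 F S Z Yp Fp \<longleftrightarrow>
     (\<forall>x\<in>{x1, x2}. (\<forall>s\<in>extensional S. simple_function M (Yp x s)) \<and>
                   (\<forall>i\<in>S. simple_function M (Fp x i))) \<and>
     (\<forall>\<omega>\<in>space M. joint (Fp (X \<omega>)) S \<omega> = joint F S \<omega> \<and>
                   Yp (X \<omega>) (joint F S \<omega>) \<omega> = Y \<omega>) \<and>
     (\<forall>x\<in>{x1, x2}. \<forall>x'\<in>{x1, x2}. \<forall>s\<in>extensional S.
        discrete_cond_indep M (joint F S) (Yp x s) (\<lambda>\<omega>. (X \<omega>, joint F Z \<omega>)) \<and>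
        discrete_cond_indep M (Yp x s) (joint (Fp x') S) (joint F Z)) \<and>
     (\<forall>x\<in>{x1, x2}. \<forall>x'\<in>{x1, x2}. \<forall>s\<in>extensional S.
        discrete_indep M X (\<lambda>\<omega>. (Yp x s \<omega>, joint (Fp x') S \<omega>, joint F Z \<omega>)))"

definition positivity :: "'a measure \<Rightarrow> ('a \<Rightarrow> 'x) \<Rightarrow> 'x \<Rightarrow> 'x \<Rightarrow> ('a \<Rightarrow> 'b) \<Rightarrow> bool" where
  "positivity M X x1 x2 V \<longleftrightarrow>
     (\<forall>v\<in>pos_values M V. \<forall>x\<in>{x1, x2}. 0 < \<P>(\<omega> in M. V \<omega> = v \<bar> X \<omega> = x))"

definition NDE ::
    "'a measure \<Rightarrow> ('a \<Rightarrow> 'x) \<Rightarrow> ('a \<Rightarrow> 'y) \<Rightarrow> 'x \<Rightarrow> 'x \<Rightarrow> ('a \<Rightarrow> 'b) \<Rightarrow> 'y \<Rightarrow> real" where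
  "NDE M X Y x1 x2 V y =
     (\<Sum>v\<in>pos_values M V.
        (\<P>(\<omega> in M. Y \<omega> = y \<bar> X \<omega> = x1 \<and> V \<omega> = v) - \<P>(\<omega> in M. Y \<omega> = y \<bar> X \<omega> = x2 \<and> V \<omega> = v))
        * \<P>(\<omega> in M. V \<omega> = v \<bar> X \<omega> = x2))"

definition NIE ::
    "'a measure \<Rightarrow> ('a \<Rightarrow> 'x) \<Rightarrow> ('a \<Rightarrow> 'y) \<Rightarrow> 'x \<Rightarrow> 'x \<Rightarrow> ('a \<Rightarrow> 'b) \<Rightarrow> 'y \<Rightarrow> real" where
  "NIE M X Y x1 x2 V y =
     (\<Sum>v\<in>pos_values M V.
        \<P>(\<omega> in M. Y \<omega> = y \<bar> X \<omega> = x1 \<and> V \<omega> = v)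
        * (\<P>(\<omega> in M. V \<omega> = v \<bar> X \<omega> = x1) - \<P>(\<omega> in M. V \<omega> = v \<bar> X \<omega> = x2)))"

text \<open>
  Asymptotic variances of the plug-in estimators of \<^const>\<open>NDE\<close> and \<^const>\<open>NIE\<close>.  There are \<open>n1\<close>
  subjects with \<open>X = x1\<close> and \<open>n2\<close> with \<open>X = x2\<close>; in group \<open>i\<close> the counts \<open>n(xi, y, v)\<close> are multinomial
  with size \<open>ni\<close> and cell probabilities \<open>pr(y, v | xi)\<close>, and the estimators substitute
  \<open>n(x, y, v) / n(x)\<close> for \<open>pr(y, v | x)\<close>.  Asymptotic variance means the variance of the estimator
  after the delta-method approximation of \<open>E(1 / n(x, v))\<close> by \<open>1 / (n(x) pr(v | x))\<close>.  It is a function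
  of \<open>n1\<close>, \<open>n2\<close> and the distribution of \<open>(X, Y, V)\<close> only.  \<open>mean_ratio\<close> is the resulting
  approximation of \<open>E(n(x2, v)\<^sup>2 / n(x1, v))\<close>.
\<close>

definition mean_ratio ::
    "'a measure \<Rightarrow> ('a \<Rightarrow> 'x) \<Rightarrow> 'x \<Rightarrow> 'x \<Rightarrow> nat \<Rightarrow> nat \<Rightarrow> ('a \<Rightarrow> 'b) \<Rightarrow> 'b \<Rightarrow> real" where
  "mean_ratio M X x1 x2 n1 n2 V v =
     (let p1 = \<P>(\<omega> in M. V \<omega> = v \<bar> X \<omega> = x1);
          p2 = \<P>(\<omega> in M. V \<omega> = v \<bar> X \<omega> = x2)
      in (real n2)\<^sup>2 / (real n1 * p1) * (p2 * (1 - p2) / real n2 + p2\<^sup>2))"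

definition avar_NDE ::
    "'a measure \<Rightarrow> ('a \<Rightarrow> 'x) \<Rightarrow> ('a \<Rightarrow> 'y) \<Rightarrow> 'x \<Rightarrow> 'x \<Rightarrow> nat \<Rightarrow> nat \<Rightarrow> ('a \<Rightarrow> 'b) \<Rightarrow> 'y \<Rightarrow> real" where
  "avar_NDE M X Y x1 x2 n1 n2 V y =
     (let q1 = (\<lambda>v. \<P>(\<omega> in M. Y \<omega> = y \<bar> X \<omega> = x1 \<and> V \<omega> = v));
          q2 = (\<lambda>v. \<P>(\<omega> in M. Y \<omega> = y \<bar> X \<omega> = x2 \<and> V \<omega> = v));
          p2 = (\<lambda>v. \<P>(\<omega> in M. V \<omega> = v \<bar> X \<omega> = x2))
      in (\<Sum>v\<in>pos_values M V. (q1 v - q2 v)\<^sup>2 * (p2 v / real n2))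
         - (NDE M X Y x1 x2 V y)\<^sup>2 / real n2
         + (\<Sum>v\<in>pos_values M V. q1 v * (1 - q1 v) / (real n2)\<^sup>2 * mean_ratio M X x1 x2 n1 n2 V v)
         + (\<Sum>v\<in>pos_values M V. q2 v * (1 - q2 v) / real n2 * p2 v))"

definition avar_NIE ::
    "'a measure \<Rightarrow> ('a \<Rightarrow> 'x) \<Rightarrow> ('a \<Rightarrow> 'y) \<Rightarrow> 'x \<Rightarrow> 'x \<Rightarrow> nat \<Rightarrow> nat \<Rightarrow> ('a \<Rightarrow> 'b) \<Rightarrow> 'y \<Rightarrow> real" where
  "avar_NIE M X Y x1 x2 n1 n2 V y =
     (let q1 = (\<lambda>v. \<P>(\<omega> in M. Y \<omega> = y \<bar> X \<omega> = x1 \<and> V \<omega> = v));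
          p2 = (\<lambda>v. \<P>(\<omega> in M. V \<omega> = v \<bar> X \<omega> = x2));
          r1 = \<P>(\<omega> in M. Y \<omega> = y \<bar> X \<omega> = x1)
      in (\<Sum>v\<in>pos_values M V. q1 v * (1 - q1 v) / (real n2)\<^sup>2 * mean_ratio M X x1 x2 n1 n2 V v)
         - 2 * (\<Sum>v\<in>pos_values M V. q1 v * (1 - q1 v) * (p2 v / real n1))
         + r1 * (1 - r1) / real n1
         + 1 / real n2 *
             ((\<Sum>v\<in>pos_values M V. (q1 v)\<^sup>2 * p2 v) - (\<Sum>v\<in>pos_values M V. q1 v * p2 v)\<^sup>2))"

definition cov ::
    "'a measure \<Rightarrow> ('a \<Rightarrow> 'x) \<Rightarrow> ('a \<Rightarrow> 'y) \<Rightarrow> 'x \<Rightarrow> 'x \<Rightarrow> 'y \<Rightarrow> ('a \<Rightarrow> 'b) \<Rightarrow> ('a \<Rightarrow> 'c) \<Rightarrow> 'c \<Rightarrow> real" where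
  "cov M X Y x1 x2 y1 U T t =
     (\<Sum>u\<in>{u. 0 < \<P>(\<omega> in M. U \<omega> = u \<bar> T \<omega> = t)}.
        \<P>(\<omega> in M. Y \<omega> = y1 \<bar> X \<omega> = x1 \<and> T \<omega> = t \<and> U \<omega> = u)
        * \<P>(\<omega> in M. Y \<omega> = y1 \<bar> X \<omega> = x2 \<and> T \<omega> = t \<and> U \<omega> = u)
        * \<P>(\<omega> in M. U \<omega> = u \<bar> T \<omega> = t))
     - \<P>(\<omega> in M. Y \<omega> = y1 \<bar> X \<omega> = x1 \<and> T \<omega> = t) * \<P>(\<omega> in M. Y \<omega> = y1 \<bar> X \<omega> = x2 \<and> T \<omega> = t)"

end

theory Submission
  imports Defs
begin

text \<open>
  Relabelling the values of \<open>U \<union> T\<close> as pairs, the sums defining the variances split into strata of the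
  smaller set, so inequalities may be proved stratum by stratum.  The approximation of
  \<open>E(n(x2, v)\<^sup>2 / n(x1, v))\<close> is a nonnegative combination of \<open>p2 / p1\<close> and \<open>p2\<^sup>2 / p1\<close>.

  In (I) the response probabilities do not change under refinement, so only this ratio matters; its two
  parts grow because \<open>p1\<close> is monotone and by Cauchy-Schwarz.

  In (II) the distribution within a stratum \<open>t\<close> is the same for \<open>x1\<close> and \<open>x2\<close>.  Writing \<open>V\<close> for the
  variance of \<open>pr(y | x1, t, u)\<close> within the stratum, the refined ratio term drops by at most \<open>V\<close> times the
  ratio of the stratum, whereas the remaining terms gain at least \<open>V pr(t | x2) / n2\<close>; for \<open>NDE\<close> this uses
  that the covariance is nonpositive.  The sample size condition says that the gain outweighs the loss.
\<close>

section \<open>Real inequalities for the approximated mean ratio\<close>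

definition ratio_approx :: "nat \<Rightarrow> nat \<Rightarrow> real \<Rightarrow> real \<Rightarrow> real" where
  "ratio_approx n1 n2 p1 p2 =
     (real n2)\<^sup>2 / (real n1 * p1) * (p2 * (1 - p2) / real n2 + p2\<^sup>2)"

lemma mean_ratio_eq_ratio_approx:
  "mean_ratio M X x1 x2 n1 n2 V v =
     ratio_approx n1 n2 (\<P>(\<omega> in M. V \<omega> = v \<bar> X \<omega> = x1)) (\<P>(\<omega> in M. V \<omega> = v \<bar> X \<omega> = x2))"
  by (simp add: mean_ratio_def ratio_approx_def Let_def)

text \<open>Collecting powers of \<open>p2\<close> shows the two parts that behave differently under
  refinement, \<open>p2 / p1\<close> and its quadratic companion, with coefficients that are
  nonnegative because \<open>n2\<close> is at least 1. In the cases \<open>n1 = 0\<close> and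
  \<open>p1 = 0\<close> both sides are 0, division by zero being 0.\<close>

lemma ratio_approx_eq:
  assumes "n2 \<ge> 1"
  shows "ratio_approx n1 n2 p1 p2 = real n2 / real n1 * (p2 / p1 + (real n2 - 1) * (p2\<^sup>2 / p1))"
  using assms by (cases "n1 = 0"; cases "p1 = 0")
    (simp_all add: ratio_approx_def field_simps power2_eq_square)

text \<open>Cauchy-Schwarz in the form of Titu's lemma, proved by summing tangent bounds.\<close>

lemma square_over_sum_le:
  fixes p r :: "'b \<Rightarrow> real"
  assumes "finite B" and p: "\<And>b. b \<in> B \<Longrightarrow> 0 < p b"
  shows "(sum r B)\<^sup>2 / sum p B \<le> (\<Sum>b\<in>B. (r b)\<^sup>2 / p b)"
proof (cases "B = {}")
  case False
  \<comment> \<open>The common slope of the tangents, chosen so that the summed bound equals the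
    left-hand side.\<close>
  define s where "s = sum r B / sum p B"
  have P: "0 < sum p B" using assms False by (intro sum_pos) auto
  have "2 * s * r b - s\<^sup>2 * p b \<le> (r b)\<^sup>2 / p b" if "b \<in> B" for b
  proof -
    have "0 \<le> (r b - s * p b)\<^sup>2 / p b" using p[OF that] by simp
    also have "\<dots> = (r b)\<^sup>2 / p b - (2 * s * r b - s\<^sup>2 * p b)"
      using p[OF that] by (simp add: field_simps power2_eq_square)
    finally show ?thesis by simp
  qed
  then have "(\<Sum>b\<in>B. 2 * s * r b - s\<^sup>2 * p b) \<le> (\<Sum>b\<in>B. (r b)\<^sup>2 / p b)" by (rule sum_mono)
  moreover have "(\<Sum>b\<in>B. 2 * s * r b - s\<^sup>2 * p b) = (sum r B)\<^sup>2 / sum p B"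
    using P unfolding sum_subtractf sum_distrib_left[symmetric] s_def
    by (simp add: field_simps power2_eq_square)
  ultimately show ?thesis by simp
qed simp

text \<open>In the linear part each denominator \<open>p b\<close> is at most
  \<open>sum p B\<close>; the quadratic part is \<open>square_over_sum_le\<close>, with the
  nonnegative weight \<open>n2 - 1\<close>.\<close>

lemma ratio_approx_sum_le:
  assumes "finite B" and p: "\<And>b. b \<in> B \<Longrightarrow> 0 < p b" and r: "\<And>b. b \<in> B \<Longrightarrow> 0 \<le> r b"
    and n: "n2 \<ge> 1"
  shows "ratio_approx n1 n2 (sum p B) (sum r B) \<le> (\<Sum>b\<in>B. ratio_approx n1 n2 (p b) (r b))"
proof -
  have "sum r B / sum p B = (\<Sum>b\<in>B. r b / sum p B)" by (rule sum_divide_distrib)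
  also have "\<dots> \<le> (\<Sum>b\<in>B. r b / p b)"
  proof (rule sum_mono)
    fix b assume b: "b \<in> B"
    have "p b \<le> sum p B" using b assms(1) p by (intro member_le_sum) (auto intro: less_imp_le)
    then show "r b / sum p B \<le> r b / p b" using p[OF b] r[OF b] by (intro divide_left_mono) auto
  qed
  finally have "sum r B / sum p B + (real n2 - 1) * ((sum r B)\<^sup>2 / sum p B)
      \<le> (\<Sum>b\<in>B. r b / p b) + (real n2 - 1) * (\<Sum>b\<in>B. (r b)\<^sup>2 / p b)"
    using n by (intro add_mono mult_left_mono square_over_sum_le assms) auto
  also have "\<dots> = (\<Sum>b\<in>B. r b / p b + (real n2 - 1) * ((r b)\<^sup>2 / p b))"
    by (simp add: sum.distrib sum_distrib_left)
  finally show ?thesis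
    unfolding ratio_approx_eq[OF n] sum_distrib_left[symmetric] by (rule mult_left_mono) simp
qed

text \<open>A common factor \<open>c\<close> cancels in the linear part and comes out once of the
  quadratic part, so only the linear part makes a difference, and there \<open>c\<close> is at most
  1.\<close>

lemma ratio_approx_scale_ge:
  assumes "0 < c" "c \<le> 1" "0 < p1" "0 \<le> p2" "n2 \<ge> 1"
  shows "c * ratio_approx n1 n2 p1 p2 \<le> ratio_approx n1 n2 (c * p1) (c * p2)"
proof -
  have "c * (p2 / p1 + (real n2 - 1) * (p2\<^sup>2 / p1)) = c * (p2 / p1) + (real n2 - 1) * (c * (p2\<^sup>2 / p1))"
    by (simp add: algebra_simps)
  also have "\<dots> \<le> p2 / p1 + (real n2 - 1) * (c * (p2\<^sup>2 / p1))"
    using assms by (intro add_right_mono mult_left_le_one_le) auto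
  also have "\<dots> = c * p2 / (c * p1) + (real n2 - 1) * ((c * p2)\<^sup>2 / (c * p1))"
    using assms by (simp add: power2_eq_square)
  finally have "real n2 / real n1 * (c * (p2 / p1 + (real n2 - 1) * (p2\<^sup>2 / p1)))
     \<le> real n2 / real n1 * (c * p2 / (c * p1) + (real n2 - 1) * ((c * p2)\<^sup>2 / (c * p1)))"
    by (rule mult_left_mono) simp
  then show ?thesis unfolding ratio_approx_eq[OF \<open>n2 \<ge> 1\<close>] by (simp add: mult.left_commute)
qed

text \<open>The only place where the sample size condition is turned into a bound: the left-hand
  side is \<open>p2 / n2\<close> times \<open>(1 + (n2 - 1) * p2) / (n1 * p1)\<close>, and the
  condition makes the second factor at most 1.\<close>

lemma ratio_approx_le:
  assumes "0 < p1" "0 \<le> p2" "n1 \<ge> 1" "n2 \<ge> 1" and "1 + real n2 * p2 \<le> real n1 * p1"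
  shows "ratio_approx n1 n2 p1 p2 / (real n2)\<^sup>2 \<le> p2 / real n2"
proof -
  have "1 + (real n2 - 1) * p2 \<le> real n1 * p1" using assms by (simp add: algebra_simps)
  then have "p2 * (1 + (real n2 - 1) * p2) \<le> p2 * (real n1 * p1)" using assms by (intro mult_left_mono)
  then have "p2 * (1 + (real n2 - 1) * p2) / (real n2 * (real n1 * p1))
      \<le> p2 * (real n1 * p1) / (real n2 * (real n1 * p1))"
    using assms by (intro divide_right_mono) auto
  also have "\<dots> = p2 / real n2" using assms by simp
  also have "p2 * (1 + (real n2 - 1) * p2) / (real n2 * (real n1 * p1))
      = ratio_approx n1 n2 p1 p2 / (real n2)\<^sup>2"
    using assms unfolding ratio_approx_eq[OF \<open>n2 \<ge> 1\<close>] by (simp add: field_simps power2_eq_square)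
  finally show ?thesis .
qed

section \<open>Inequalities within one stratum\<close>

text \<open>The difference of the two sides is the variance of \<open>q\<close> under the weights
  \<open>c\<close>.\<close>

lemma square_mean_le:
  fixes c q :: "'b \<Rightarrow> real"
  assumes "\<And>b. b \<in> B \<Longrightarrow> 0 \<le> c b" "sum c B = 1"
  shows "(\<Sum>b\<in>B. c b * q b)\<^sup>2 \<le> (\<Sum>b\<in>B. c b * (q b)\<^sup>2)"
proof -
  define m where "m = (\<Sum>b\<in>B. c b * q b)"
  have "0 \<le> (\<Sum>b\<in>B. c b * (q b - m)\<^sup>2)" using assms by (intro sum_nonneg) auto
  also have "\<dots> = (\<Sum>b\<in>B. c b * (q b)\<^sup>2 - 2 * m * (c b * q b) + m\<^sup>2 * c b)"
    by (rule sum.cong) (auto simp: power2_eq_square algebra_simps)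
  also have "\<dots> = (\<Sum>b\<in>B. c b * (q b)\<^sup>2) - m\<^sup>2"
    unfolding sum.distrib sum_subtractf sum_distrib_left[symmetric] m_def[symmetric]
    using assms by (simp add: power2_eq_square)
  finally show ?thesis by (simp add: m_def)
qed

text \<open>Refining a stratum loses the variance of \<open>q\<close> from the binomial variance, but no more.\<close>

lemma binomial_ratio_ge:
  fixes c q :: "'b \<Rightarrow> real"
  assumes "finite B" and c: "\<And>b. b \<in> B \<Longrightarrow> 0 < c b" "sum c B = 1"
    and q: "\<And>b. b \<in> B \<Longrightarrow> 0 \<le> q b \<and> q b \<le> 1"
    and "0 < p1" "0 \<le> p2" "n2 \<ge> 1"
  shows "((\<Sum>b\<in>B. c b * q b) - (\<Sum>b\<in>B. c b * (q b)\<^sup>2)) / (real n2)\<^sup>2 * ratio_approx n1 n2 p1 p2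
    \<le> (\<Sum>b\<in>B. q b * (1 - q b) / (real n2)\<^sup>2 * ratio_approx n1 n2 (p1 * c b) (p2 * c b))"
proof -
  have "((\<Sum>b\<in>B. c b * q b) - (\<Sum>b\<in>B. c b * (q b)\<^sup>2)) / (real n2)\<^sup>2 * ratio_approx n1 n2 p1 p2
      = (\<Sum>b\<in>B. q b * (1 - q b) / (real n2)\<^sup>2 * (c b * ratio_approx n1 n2 p1 p2))"
    unfolding sum_subtractf[symmetric] sum_divide_distrib sum_distrib_right
    by (intro sum.cong) (simp_all add: algebra_simps power2_eq_square diff_divide_distrib)
  also have "\<dots> \<le> (\<Sum>b\<in>B. q b * (1 - q b) / (real n2)\<^sup>2 * ratio_approx n1 n2 (c b * p1) (c b * p2))"
  proof (intro sum_mono mult_left_mono ratio_approx_scale_ge)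
    fix b assume b: "b \<in> B"
    then show "c b \<le> 1" using member_le_sum[OF b, of c] assms(1) c by (auto intro: less_imp_le)
  qed (use assms in auto)
  finally show ?thesis by (simp add: mult.commute)
qed

text \<open>Let V be the variance \<open>E - Q^2\<close> of \<open>q\<close>. Refinement raises the
  squared term by \<open>V * p2 / n2\<close>, which pays for the loss in the ratio term; the
  subtracted binomial term shrinks, a further gain of \<open>2 * V * p2 / n1\<close>.\<close>

lemma stratum_NIE_le:
  fixes c q :: "'b \<Rightarrow> real"
  assumes "finite B" and c: "\<And>b. b \<in> B \<Longrightarrow> 0 < c b" "sum c B = 1"
    and q: "\<And>b. b \<in> B \<Longrightarrow> 0 \<le> q b \<and> q b \<le> 1" and Q: "Q = (\<Sum>b\<in>B. c b * q b)"
    and p: "0 < p1" "0 \<le> p2" and n: "n1 \<ge> 1" "n2 \<ge> 1" "1 + real n2 * p2 \<le> real n1 * p1"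
  shows "Q * (1 - Q) / (real n2)\<^sup>2 * ratio_approx n1 n2 p1 p2
           - 2 * (Q * (1 - Q) * (p2 / real n1)) + Q\<^sup>2 * p2 / real n2
      \<le> (\<Sum>b\<in>B. q b * (1 - q b) / (real n2)\<^sup>2 * ratio_approx n1 n2 (p1 * c b) (p2 * c b))
           - 2 * (\<Sum>b\<in>B. q b * (1 - q b) * (p2 * c b / real n1))
           + (\<Sum>b\<in>B. (q b)\<^sup>2 * (p2 * c b)) / real n2"
proof -
  define E where "E = (\<Sum>b\<in>B. c b * (q b)\<^sup>2)"
  define r where "r = ratio_approx n1 n2 p1 p2"
  have sq: "Q\<^sup>2 \<le> E" unfolding Q E_def using c by (intro square_mean_le) (auto intro: less_imp_le)
  have r: "r / (real n2)\<^sup>2 \<le> p2 / real n2" unfolding r_def using p n by (intro ratio_approx_le)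
  have 1: "(Q - E) / (real n2)\<^sup>2 * r
      \<le> (\<Sum>b\<in>B. q b * (1 - q b) / (real n2)\<^sup>2 * ratio_approx n1 n2 (p1 * c b) (p2 * c b))"
    unfolding Q E_def r_def using assms by (intro binomial_ratio_ge)
  have 2: "(\<Sum>b\<in>B. q b * (1 - q b) * (p2 * c b / real n1)) = (Q - E) * (p2 / real n1)"
    unfolding Q E_def sum_subtractf[symmetric] sum_distrib_right
    by (intro sum.cong) (auto simp: field_simps power2_eq_square)
  have 3: "(\<Sum>b\<in>B. (q b)\<^sup>2 * (p2 * c b)) = E * p2"
    unfolding E_def sum_distrib_right by (intro sum.cong) auto
  \<comment> \<open>On the left the largest possible loss of the ratio term, on the right the gain
    of the squared term.\<close>
  have "(E - Q\<^sup>2) * (r / (real n2)\<^sup>2) \<le> (E - Q\<^sup>2) * (p2 / real n2)"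
    using sq r by (intro mult_left_mono) auto
  moreover have "0 \<le> (E - Q\<^sup>2) * (p2 / real n1)" using sq p by simp
  moreover have "Q * (1 - Q) / (real n2)\<^sup>2 * r - (Q - E) / (real n2)\<^sup>2 * r = (E - Q\<^sup>2) * (r / (real n2)\<^sup>2)"
    using n by (simp add: field_simps power2_eq_square)
  moreover have "E * p2 / real n2 - Q\<^sup>2 * p2 / real n2 = (E - Q\<^sup>2) * (p2 / real n2)"
    by (simp add: algebra_simps diff_divide_distrib)
  moreover have "Q * (1 - Q) * (p2 / real n1) - (Q - E) * (p2 / real n1) = (E - Q\<^sup>2) * (p2 / real n1)"
    unfolding left_diff_distrib[symmetric] by (simp add: algebra_simps power2_eq_square)
  ultimately show ?thesis using 1 unfolding 2 3 r_def[symmetric] by linarith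
qed

text \<open>The gain now comes from the squared difference of the responses, whose second moment
  contains the cross moment \<open>C\<close>. The bound on \<open>C\<close> by the product of the
  means keeps the gain at least the variance of \<open>q1\<close> times \<open>p2 / n2\<close>,
  which covers the loss in the ratio term.\<close>

lemma stratum_NDE_le:
  fixes c q1 q2 :: "'b \<Rightarrow> real"
  assumes "finite B" and c: "\<And>b. b \<in> B \<Longrightarrow> 0 < c b" "sum c B = 1"
    and q: "\<And>b. b \<in> B \<Longrightarrow> 0 \<le> q1 b \<and> q1 b \<le> 1"
    and Q1: "Q1 = (\<Sum>b\<in>B. c b * q1 b)" and Q2: "Q2 = (\<Sum>b\<in>B. c b * q2 b)"
    and cov: "(\<Sum>b\<in>B. c b * (q1 b * q2 b)) \<le> Q1 * Q2"
    and p: "0 < p1" "0 \<le> p2" and n: "n1 \<ge> 1" "n2 \<ge> 1" "1 + real n2 * p2 \<le> real n1 * p1"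
  shows "(Q1 - Q2)\<^sup>2 * (p2 / real n2) + Q1 * (1 - Q1) / (real n2)\<^sup>2 * ratio_approx n1 n2 p1 p2
           + Q2 * (1 - Q2) / real n2 * p2
      \<le> (\<Sum>b\<in>B. (q1 b - q2 b)\<^sup>2 * (p2 * c b / real n2))
           + (\<Sum>b\<in>B. q1 b * (1 - q1 b) / (real n2)\<^sup>2 * ratio_approx n1 n2 (p1 * c b) (p2 * c b))
           + (\<Sum>b\<in>B. q2 b * (1 - q2 b) / real n2 * (p2 * c b))"
proof -
  define E1 where "E1 = (\<Sum>b\<in>B. c b * (q1 b)\<^sup>2)"
  define E2 where "E2 = (\<Sum>b\<in>B. c b * (q2 b)\<^sup>2)"
  define C where "C = (\<Sum>b\<in>B. c b * (q1 b * q2 b))"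
  define r where "r = ratio_approx n1 n2 p1 p2"
  define k where "k = p2 / real n2"
  have sq: "Q1\<^sup>2 \<le> E1" unfolding Q1 E1_def using c by (intro square_mean_le) (auto intro: less_imp_le)
  have r: "r / (real n2)\<^sup>2 \<le> k" unfolding r_def k_def using p n by (intro ratio_approx_le)
  have 1: "(Q1 - E1) / (real n2)\<^sup>2 * r
      \<le> (\<Sum>b\<in>B. q1 b * (1 - q1 b) / (real n2)\<^sup>2 * ratio_approx n1 n2 (p1 * c b) (p2 * c b))"
    unfolding Q1 E1_def r_def using assms by (intro binomial_ratio_ge)
  have 2: "(\<Sum>b\<in>B. (q1 b - q2 b)\<^sup>2 * (p2 * c b / real n2)) = (E1 - 2 * C + E2) * k"
    unfolding E1_def E2_def C_def k_def sum_distrib_left sum_subtractf[symmetric] sum.distrib[symmetric]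
      sum_distrib_right
    by (intro sum.cong) (auto simp: field_simps power2_eq_square)
  have 3: "(\<Sum>b\<in>B. q2 b * (1 - q2 b) / real n2 * (p2 * c b)) = (Q2 - E2) * k"
    unfolding Q2 E2_def k_def sum_subtractf[symmetric] sum_distrib_right
    by (intro sum.cong) (auto simp: field_simps power2_eq_square)
  have 4: "Q2 * (1 - Q2) / real n2 * p2 = (Q2 - Q2\<^sup>2) * k" "(Q1 - Q2)\<^sup>2 * (p2 / real n2) = (Q1 - Q2)\<^sup>2 * k"
    by (simp_all add: k_def right_diff_distrib power2_eq_square)
  have "(E1 - Q1\<^sup>2) * (r / (real n2)\<^sup>2) \<le> (E1 - Q1\<^sup>2) * k"
    using sq r by (intro mult_left_mono) auto
  moreover have "0 \<le> (Q1 * Q2 - C) * k" using cov p by (simp add: C_def k_def)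
  moreover have "Q1 * (1 - Q1) / (real n2)\<^sup>2 * r - (Q1 - E1) / (real n2)\<^sup>2 * r = (E1 - Q1\<^sup>2) * (r / (real n2)\<^sup>2)"
    using n by (simp add: field_simps power2_eq_square)
  \<comment> \<open>\<open>E2\<close> cancels: what the squared difference gains from the variance
    of \<open>q2\<close>, the binomial term of \<open>q2\<close> loses.\<close>
  moreover have "(E1 - 2 * C + E2) * k + (Q2 - E2) * k - ((Q2 - Q2\<^sup>2) * k + (Q1 - Q2)\<^sup>2 * k)
      = (E1 - Q1\<^sup>2) * k + 2 * ((Q1 * Q2 - C) * k)"
    by (simp add: algebra_simps power2_eq_square)
  ultimately show ?thesis using 1 unfolding 2 3 4 r_def[symmetric] by linarith
qed

section \<open>Joint values and the relabelling of values\<close>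

lemma restrict_eq_iff: "restrict f A = restrict g A \<longleftrightarrow> (\<forall>i\<in>A. f i = g i)"
proof
  assume eq: "restrict f A = restrict g A"
  show "\<forall>i\<in>A. f i = g i"
  proof
    fix i assume "i \<in> A"
    with fun_cong[OF eq, of i] show "f i = g i" by simp
  qed
qed (auto intro: restrict_ext)

lemma simple_function_joint:
  assumes "finite I" and F: "\<And>i. i \<in> I \<Longrightarrow> simple_function M (F i)"
  shows "simple_function M (joint F I)"
  unfolding simple_function_def
proof (intro conjI ballI)
  have "joint F I ` space M \<subseteq> (\<Pi>\<^sub>E i\<in>I. F i ` space M)" by (auto simp: joint_def)
  moreover have "finite (\<Pi>\<^sub>E i\<in>I. F i ` space M)"
    using assms by (intro finite_PiE) (auto dest: simple_functionD)
  ultimately show "finite (joint F I ` space M)" by (rule finite_subset)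
  fix g assume "g \<in> joint F I ` space M"
  then obtain \<omega> where g: "g = joint F I \<omega>" by auto
  have "joint F I \<omega>' = g \<longleftrightarrow> (\<forall>i\<in>I. F i \<omega>' = g i)" for \<omega>'
    unfolding g joint_def restrict_eq_iff by simp
  then have "joint F I -` {g} \<inter> space M = {\<omega> \<in> space M. \<forall>i\<in>I. \<omega> \<in> F i -` {g i} \<inter> space M}"
    by auto
  also have "\<dots> \<in> sets M"
    using assms by (intro sets.sets_Collect_finite_All) (auto dest: simple_functionD)
  finally show "joint F I -` {g} \<inter> space M \<in> sets M" .
qed

text \<open>\<open>A\<close> and \<open>B\<close> may overlap, so pairs that disagree on the overlap
  are not hit. Injectivity is enough, as such pairs never occur as values.\<close>

lemma inj_on_restrict_pair: "inj_on (\<lambda>f. (restrict f A, restrict f B)) (extensional (A \<union> B))"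
proof (rule inj_onI)
  fix f g :: "'a \<Rightarrow> 'b"
  assume fg: "f \<in> extensional (A \<union> B)" "g \<in> extensional (A \<union> B)"
    "(restrict f A, restrict f B) = (restrict g A, restrict g B)"
  then show "f = g"
    by (intro extensionalityI[of f "A \<union> B" g]) (auto simp: restrict_eq_iff)
qed

lemma pos_values_subset_image: "pos_values M V \<subseteq> V ` space M"
proof
  fix v assume "v \<in> pos_values M V"
  then have "{\<omega> \<in> space M. V \<omega> = v} \<noteq> {}"
    unfolding pos_values_def by (metis (mono_tags, lifting) measure_empty less_irrefl mem_Collect_eq)
  then show "v \<in> V ` space M" by auto
qed

text \<open>Values of positive probability are attained, so a map that is injective on the attained
  values preserves their level sets and merely renames them.\<close>

lemma relabel:
  assumes inj: "inj_on h (V ` space M)"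
  shows pos_values_relabel: "pos_values M (\<lambda>\<omega>. h (V \<omega>)) = h ` pos_values M V"
    and inj_on_pos_values: "inj_on h (pos_values M V)"
    and relabel_eq: "\<And>v \<omega>. v \<in> pos_values M V \<Longrightarrow> \<omega> \<in> space M \<Longrightarrow> h (V \<omega>) = h v \<longleftrightarrow> V \<omega> = v"
proof -
  note sub = pos_values_subset_image
  have eq: "{\<omega> \<in> space M. h (V \<omega>) = h v} = {\<omega> \<in> space M. V \<omega> = v}" if "v \<in> V ` space M" for v
    using inj that by (auto dest: inj_onD)
  show "pos_values M (\<lambda>\<omega>. h (V \<omega>)) = h ` pos_values M V"
  proof (intro equalityI subsetI)
    fix w assume w: "w \<in> pos_values M (\<lambda>\<omega>. h (V \<omega>))"
    then obtain \<omega> where "\<omega> \<in> space M" "w = h (V \<omega>)" using sub[of M "\<lambda>\<omega>. h (V \<omega>)"] by blast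
    then show "w \<in> h ` pos_values M V" using w eq[of "V \<omega>"] by (auto simp: pos_values_def)
  next
    fix w assume "w \<in> h ` pos_values M V"
    then obtain v where v: "v \<in> pos_values M V" "w = h v" by auto
    then show "w \<in> pos_values M (\<lambda>\<omega>. h (V \<omega>))" using eq[of v] sub[of M V] by (auto simp: pos_values_def)
  qed
  show "inj_on h (pos_values M V)" using inj sub by (rule inj_on_subset)
  show "h (V \<omega>) = h v \<longleftrightarrow> V \<omega> = v" if "v \<in> pos_values M V" "\<omega> \<in> space M" for v \<omega>
    using that inj sub[of M V] by (auto dest: inj_onD)
qed

lemma cond_prob_cong:
  assumes "\<And>\<omega>. \<omega> \<in> space M \<Longrightarrow> P \<omega> = P' \<omega>" "\<And>\<omega>. \<omega> \<in> space M \<Longrightarrow> Q \<omega> = Q' \<omega>"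
  shows "\<P>(\<omega> in M. P \<omega> \<bar> Q \<omega>) = \<P>(\<omega> in M. P' \<omega> \<bar> Q' \<omega>)"
  unfolding cond_prob_def using assms
  by (intro arg_cong2[where f = "(/)"] arg_cong[where f = "measure M"]) auto

lemma relabel_cond_prob:
  assumes "inj_on h (V ` space M)" "v \<in> pos_values M V"
  shows "\<P>(\<omega> in M. h (V \<omega>) = h v \<bar> Q \<omega>) = \<P>(\<omega> in M. V \<omega> = v \<bar> Q \<omega>)"
    and "\<P>(\<omega> in M. P \<omega> \<bar> X \<omega> = x \<and> h (V \<omega>) = h v) = \<P>(\<omega> in M. P \<omega> \<bar> X \<omega> = x \<and> V \<omega> = v)"
  using relabel_eq[OF assms] by (auto intro!: cond_prob_cong)

lemma NDE_relabel:
  assumes "inj_on h (V ` space M)"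
  shows "NDE M X Y x1 x2 (\<lambda>\<omega>. h (V \<omega>)) y = NDE M X Y x1 x2 V y"
  unfolding NDE_def pos_values_relabel[OF assms] sum.reindex[OF inj_on_pos_values[OF assms]] o_def
  by (intro sum.cong) (simp_all add: relabel_cond_prob[OF assms])

lemma avar_relabel:
  assumes "inj_on h (V ` space M)"
  shows "avar_NDE M X Y x1 x2 n1 n2 (\<lambda>\<omega>. h (V \<omega>)) y = avar_NDE M X Y x1 x2 n1 n2 V y"
    and "avar_NIE M X Y x1 x2 n1 n2 (\<lambda>\<omega>. h (V \<omega>)) y = avar_NIE M X Y x1 x2 n1 n2 V y"
  unfolding avar_NDE_def avar_NIE_def Let_def NDE_relabel[OF assms] mean_ratio_eq_ratio_approx
    pos_values_relabel[OF assms] sum.reindex[OF inj_on_pos_values[OF assms]] o_def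
  by (simp_all add: relabel_cond_prob[OF assms] cong: sum.cong_simp)

lemma positivity_relabel:
  assumes "inj_on h (V ` space M)"
  shows "positivity M X x1 x2 (\<lambda>\<omega>. h (V \<omega>)) \<longleftrightarrow> positivity M X x1 x2 V"
  unfolding positivity_def pos_values_relabel[OF assms]
  by (simp add: relabel_cond_prob[OF assms])


section \<open>Strata of a coarse variable \<open>A\<close> and their cells under refinement by
  \<open>B\<close>\<close>

locale stratified = prob_space M for M :: "'a measure" +
  fixes X :: "'a \<Rightarrow> 'x" and Y :: "'a \<Rightarrow> 'y" and A :: "'a \<Rightarrow> 'b" and B :: "'a \<Rightarrow> 'c" and x1 x2 :: 'x
  assumes simple: "simple_function M X" "simple_function M Y" "simple_function M A" "simple_function M B"
    and pos: "positivity M X x1 x2 A" "positivity M X x1 x2 (\<lambda>\<omega>. (A \<omega>, B \<omega>))"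
begin

lemmas measurable_simple[measurable] = simple[THEN measurable_simple_function]

text \<open>The fibre over \<open>a\<close> of the projection from the positive values of the pair;
  it turns sums over pairs into nested sums over strata and cells.\<close>

definition "fib a = {b. 0 < \<P>(\<omega> in M. A \<omega> = a \<and> B \<omega> = b)}"

lemma fib_subset_image: "fib a \<subseteq> B ` space M"
proof
  fix b assume "b \<in> fib a"
  then have "{\<omega> \<in> space M. A \<omega> = a \<and> B \<omega> = b} \<noteq> {}"
    unfolding fib_def by (metis (mono_tags, lifting) measure_empty less_irrefl mem_Collect_eq)
  then show "b \<in> B ` space M" by auto
qed

lemma finite_fib [simp, intro]: "finite (fib a)"
  by (rule finite_subset[OF fib_subset_image]) (use simple in \<open>auto dest: simple_functionD\<close>)

lemma prob_mono:
  assumes "\<And>\<omega>. \<omega> \<in> space M \<Longrightarrow> P \<omega> \<Longrightarrow> Q \<omega>" "Measurable.pred M Q"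
  shows "\<P>(\<omega> in M. P \<omega>) \<le> \<P>(\<omega> in M. Q \<omega>)"
  using assms by (intro finite_measure_mono) auto

text \<open>Total probability. A cell outside \<open>fib a\<close> is null, hence so is its
  intersection with any event \<open>P\<close>. Leaving \<open>P\<close> free serves the treatment
  alone, treatment with response, and the trivial event.\<close>

lemma marginal:
  assumes [measurable]: "Measurable.pred M P"
  shows "\<P>(\<omega> in M. P \<omega> \<and> A \<omega> = a) = (\<Sum>b\<in>fib a. \<P>(\<omega> in M. P \<omega> \<and> A \<omega> = a \<and> B \<omega> = b))"
proof -
  have fin: "finite (B ` space M)" using simple by (auto dest: simple_functionD)
  have "\<P>(\<omega> in M. P \<omega> \<and> A \<omega> = a)
      = prob (\<Union>b\<in>B ` space M. {\<omega> \<in> space M. P \<omega> \<and> A \<omega> = a \<and> B \<omega> = b})"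
    by (rule arg_cong[where f = prob]) auto
  also have "\<dots> = (\<Sum>b\<in>B ` space M. \<P>(\<omega> in M. P \<omega> \<and> A \<omega> = a \<and> B \<omega> = b))"
    using fin by (intro finite_measure_finite_Union) (auto simp: disjoint_family_on_def)
  also have "\<dots> = (\<Sum>b\<in>fib a. \<P>(\<omega> in M. P \<omega> \<and> A \<omega> = a \<and> B \<omega> = b))"
  proof (rule sum.mono_neutral_right[OF fin])
    show "fib a \<subseteq> B ` space M" by (rule fib_subset_image)
    show "\<forall>b\<in>B ` space M - fib a. \<P>(\<omega> in M. P \<omega> \<and> A \<omega> = a \<and> B \<omega> = b) = 0"
    proof
      fix b assume "b \<in> B ` space M - fib a"
      then have "\<P>(\<omega> in M. A \<omega> = a \<and> B \<omega> = b) \<le> 0" by (simp add: fib_def not_less)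
      moreover have "\<P>(\<omega> in M. P \<omega> \<and> A \<omega> = a \<and> B \<omega> = b) \<le> \<P>(\<omega> in M. A \<omega> = a \<and> B \<omega> = b)"
        by (rule prob_mono) auto
      ultimately show "\<P>(\<omega> in M. P \<omega> \<and> A \<omega> = a \<and> B \<omega> = b) = 0"
        using measure_nonneg[of M "{\<omega> \<in> space M. P \<omega> \<and> A \<omega> = a \<and> B \<omega> = b}"] by linarith
    qed
  qed
  finally show ?thesis .
qed

lemma pos_values_pair: "pos_values M (\<lambda>\<omega>. (A \<omega>, B \<omega>)) = (SIGMA a:pos_values M A. fib a)"
proof -
  have "0 < \<P>(\<omega> in M. A \<omega> = a)" if "0 < \<P>(\<omega> in M. A \<omega> = a \<and> B \<omega> = b)" for a b
    using that prob_mono[of "\<lambda>\<omega>. A \<omega> = a \<and> B \<omega> = b" "\<lambda>\<omega>. A \<omega> = a"] by auto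
  then show ?thesis by (auto simp: pos_values_def fib_def)
qed

lemma finite_pos_values: "finite (pos_values M A)"
  by (rule finite_subset[OF pos_values_subset_image]) (use simple in \<open>auto dest: simple_functionD\<close>)

lemma sum_pair:
  "sum f (pos_values M (\<lambda>\<omega>. (A \<omega>, B \<omega>))) = (\<Sum>a\<in>pos_values M A. \<Sum>b\<in>fib a. f (a, b))"
  unfolding pos_values_pair using finite_pos_values by (simp add: sum.Sigma)

abbreviation "p x a \<equiv> \<P>(\<omega> in M. A \<omega> = a \<bar> X \<omega> = x)"
abbreviation "p' x a b \<equiv> \<P>(\<omega> in M. (A \<omega>, B \<omega>) = (a, b) \<bar> X \<omega> = x)"
abbreviation "q y x a \<equiv> \<P>(\<omega> in M. Y \<omega> = y \<bar> X \<omega> = x \<and> A \<omega> = a)"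
abbreviation "q' y x a b \<equiv> \<P>(\<omega> in M. Y \<omega> = y \<bar> X \<omega> = x \<and> (A \<omega>, B \<omega>) = (a, b))"

lemma p_pos: "a \<in> pos_values M A \<Longrightarrow> x \<in> {x1, x2} \<Longrightarrow> 0 < p x a"
  using pos by (auto simp: positivity_def)

lemma p'_pos: "a \<in> pos_values M A \<Longrightarrow> b \<in> fib a \<Longrightarrow> x \<in> {x1, x2} \<Longrightarrow> 0 < p' x a b"
  using pos(2) unfolding positivity_def pos_values_pair by blast

lemma p_eq_sum: "p x a = (\<Sum>b\<in>fib a. p' x a b)"
  using marginal[of "\<lambda>\<omega>. X \<omega> = x" a]
  by (simp add: cond_prob_def sum_divide_distrib[symmetric] conj_ac)

text \<open>Each product is a joint probability divided by that of \<open>X = x\<close>, so this is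
  again total probability.\<close>

lemma qp_eq_sum: "q y x a * p x a = (\<Sum>b\<in>fib a. q' y x a b * p' x a b)"
proof -
  \<comment> \<open>Covers the chain rule when the conditioning event is null: the conditional
    probability is 0 by convention and the joint probability is 0 as well.\<close>
  have zero: "\<P>(\<omega> in M. P \<omega> \<and> Q \<omega>) = 0"
    if "\<P>(\<omega> in M. Q \<omega>) = 0" "Measurable.pred M Q" for P Q
    using prob_mono[of "\<lambda>\<omega>. P \<omega> \<and> Q \<omega>" Q] that
      measure_nonneg[of M "{\<omega> \<in> space M. P \<omega> \<and> Q \<omega>}"] by simp
  have 1: "\<P>(\<omega> in M. P \<omega> \<bar> X \<omega> = x \<and> Q \<omega>) * \<P>(\<omega> in M. Q \<omega> \<bar> X \<omega> = x)
      = \<P>(\<omega> in M. (P \<omega> \<and> X \<omega> = x) \<and> Q \<omega>) / \<P>(\<omega> in M. X \<omega> = x)"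
    if [measurable]: "Measurable.pred M Q" for P Q
    using zero[of "\<lambda>\<omega>. X \<omega> = x \<and> Q \<omega>" P] by (auto simp: cond_prob_def conj_ac)
  show ?thesis
    using marginal[of "\<lambda>\<omega>. Y \<omega> = y \<and> X \<omega> = x" a]
    by (simp add: 1 sum_divide_distrib[symmetric])
qed

lemma cond_prob_bounds: "0 \<le> \<P>(\<omega> in M. P \<omega> \<bar> Q \<omega>)" "Measurable.pred M Q \<Longrightarrow> \<P>(\<omega> in M. P \<omega> \<bar> Q \<omega>) \<le> 1"
  using prob_mono[of "\<lambda>\<omega>. P \<omega> \<and> Q \<omega>" Q] by (auto simp: cond_prob_def divide_le_eq_1 order_less_le)

lemma q'_bounds: "0 \<le> q' y x a b \<and> q' y x a b \<le> 1"
  by (intro conjI cond_prob_bounds) auto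

lemma q_bounds: "0 \<le> q y x a \<and> q y x a \<le> 1"
  by (intro conjI cond_prob_bounds) auto

lemma sum_const_stratum: "(\<Sum>b\<in>fib a. k * (p' x a b / m)) = k * (p x a / m)"
  unfolding p_eq_sum by (simp add: sum_distrib_left sum_divide_distrib)

context
  fixes y :: 'y and n1 n2 :: nat
  assumes n: "n1 \<ge> 1" "n2 \<ge> 1"
begin

section \<open>Part (I): refinement that keeps the response probabilities\<close>

context
  assumes ci: "discrete_cond_indep M Y B (\<lambda>\<omega>. (X \<omega>, A \<omega>))"
begin

text \<open>Positivity makes the cell non-null in each treatment group, so the factor of
  \<open>B\<close> in the conditional independence can be cancelled.\<close>

lemma q'_eq_q:
  assumes ab: "a \<in> pos_values M A" "b \<in> fib a" and x: "x \<in> {x1, x2}"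
  shows "q' y x a b = q y x a"
proof -
  have 1: "\<P>(\<omega> in M. X \<omega> = x \<and> A \<omega> = a \<and> B \<omega> = b) \<noteq> 0"
    using p'_pos[OF ab x] by (auto simp: cond_prob_def conj_ac)
  then have 2: "\<P>(\<omega> in M. X \<omega> = x \<and> A \<omega> = a) \<noteq> 0"
    using prob_mono[of "\<lambda>\<omega>. X \<omega> = x \<and> A \<omega> = a \<and> B \<omega> = b" "\<lambda>\<omega>. X \<omega> = x \<and> A \<omega> = a"]
      measure_nonneg[of M "{\<omega> \<in> space M. X \<omega> = x \<and> A \<omega> = a \<and> B \<omega> = b}"] by force
  then have "(x, a) \<in> pos_values M (\<lambda>\<omega>. (X \<omega>, A \<omega>))" by (simp add: pos_values_def zero_less_measure_iff)
  then have "\<P>(\<omega> in M. Y \<omega> = y \<and> B \<omega> = b \<bar> (X \<omega>, A \<omega>) = (x, a))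
      = \<P>(\<omega> in M. Y \<omega> = y \<bar> (X \<omega>, A \<omega>) = (x, a)) * \<P>(\<omega> in M. B \<omega> = b \<bar> (X \<omega>, A \<omega>) = (x, a))"
    using ci unfolding discrete_cond_indep_def by blast
  with 1 2 show ?thesis by (simp add: cond_prob_def field_simps conj_ac)
qed

text \<open>Made for the terms linear in \<open>p2\<close> whose other factor depends on the
  responses only and so is constant on a stratum. \<open>m\<close> is the sample size dividing
  \<open>p2\<close>, or 1 if there is none.\<close>

lemma sum_refine:
  assumes "\<And>a b. a \<in> pos_values M A \<Longrightarrow> b \<in> fib a \<Longrightarrow> f (a, b) = g a * (p' x2 a b / m)"
  shows "sum f (pos_values M (\<lambda>\<omega>. (A \<omega>, B \<omega>))) = (\<Sum>a\<in>pos_values M A. g a * (p x2 a / m))"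
  unfolding sum_pair sum_const_stratum[symmetric] by (intro sum.cong refl assms)

text \<open>The response factor is nonnegative and constant on a stratum, which leaves
  \<open>ratio_approx_sum_le\<close>. This is the only strict change between the two variances in
  part (I).\<close>

lemma ratio_refine:
  "(\<Sum>a\<in>pos_values M A. q y x1 a * (1 - q y x1 a) / (real n2)\<^sup>2 * mean_ratio M X x1 x2 n1 n2 A a)
   \<le> (\<Sum>v\<in>pos_values M (\<lambda>\<omega>. (A \<omega>, B \<omega>)).
       \<P>(\<omega> in M. Y \<omega> = y \<bar> X \<omega> = x1 \<and> (A \<omega>, B \<omega>) = v) * (1 - \<P>(\<omega> in M. Y \<omega> = y \<bar> X \<omega> = x1 \<and> (A \<omega>, B \<omega>) = v))
         / (real n2)\<^sup>2 * mean_ratio M X x1 x2 n1 n2 (\<lambda>\<omega>. (A \<omega>, B \<omega>)) v)"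
  unfolding sum_pair mean_ratio_eq_ratio_approx
proof (rule sum_mono)
  fix a assume a: "a \<in> pos_values M A"
  have "q y x1 a * (1 - q y x1 a) / (real n2)\<^sup>2 * ratio_approx n1 n2 (p x1 a) (p x2 a)
     \<le> q y x1 a * (1 - q y x1 a) / (real n2)\<^sup>2 * (\<Sum>b\<in>fib a. ratio_approx n1 n2 (p' x1 a b) (p' x2 a b))"
    unfolding p_eq_sum using a q_bounds[of y x1 a] n p'_pos
    by (intro mult_left_mono ratio_approx_sum_le) (auto intro: less_imp_le)
  also have "\<dots> = (\<Sum>b\<in>fib a. q' y x1 a b * (1 - q' y x1 a b) / (real n2)\<^sup>2
      * ratio_approx n1 n2 (p' x1 a b) (p' x2 a b))"
    unfolding sum_distrib_left using a by (intro sum.cong refl) (simp only: q'_eq_q insert_iff simp_thms)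
  finally show "q y x1 a * (1 - q y x1 a) / (real n2)\<^sup>2 * ratio_approx n1 n2 (p x1 a) (p x2 a) \<le> \<dots>" .
qed

lemma avar_NDE_le_refine:
  assumes "NDE M X Y x1 x2 A y = NDE M X Y x1 x2 (\<lambda>\<omega>. (A \<omega>, B \<omega>)) y"
  shows "avar_NDE M X Y x1 x2 n1 n2 A y \<le> avar_NDE M X Y x1 x2 n1 n2 (\<lambda>\<omega>. (A \<omega>, B \<omega>)) y"
  unfolding avar_NDE_def Let_def assms
  by (intro add_mono diff_mono order_refl ratio_refine eq_refl[OF sym]
      sum_refine sum_refine[where m = 1, unfolded div_by_1]) (simp_all only: q'_eq_q insert_iff simp_thms)

lemma avar_NIE_le_refine:
  "avar_NIE M X Y x1 x2 n1 n2 A y \<le> avar_NIE M X Y x1 x2 n1 n2 (\<lambda>\<omega>. (A \<omega>, B \<omega>)) y"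
proof -
  let ?q = "\<lambda>v. \<P>(\<omega> in M. Y \<omega> = y \<bar> X \<omega> = x1 \<and> (A \<omega>, B \<omega>) = v)"
  let ?p = "\<lambda>v. \<P>(\<omega> in M. (A \<omega>, B \<omega>) = v \<bar> X \<omega> = x2)"
  let ?V = "pos_values M (\<lambda>\<omega>. (A \<omega>, B \<omega>))"
  have "(\<Sum>v\<in>?V. ?q v * (1 - ?q v) * (?p v / real n1))
      = (\<Sum>a\<in>pos_values M A. q y x1 a * (1 - q y x1 a) * (p x2 a / real n1))"
    by (rule sum_refine) (simp only: q'_eq_q insert_iff simp_thms)
  moreover have "(\<Sum>v\<in>?V. (?q v)\<^sup>2 * ?p v) = (\<Sum>a\<in>pos_values M A. (q y x1 a)\<^sup>2 * p x2 a)"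
    by (rule sum_refine[where m = 1, unfolded div_by_1]) (simp only: q'_eq_q insert_iff simp_thms)
  moreover have "(\<Sum>v\<in>?V. ?q v * ?p v) = (\<Sum>a\<in>pos_values M A. q y x1 a * p x2 a)"
    by (rule sum_refine[where m = 1, unfolded div_by_1]) (simp only: q'_eq_q insert_iff simp_thms)
  ultimately show ?thesis
    unfolding avar_NIE_def Let_def using ratio_refine by simp
qed

end

section \<open>Part (II): refinement whose weights within a stratum do not depend on the
  treatment\<close>

context
  assumes ci: "discrete_cond_indep M X B A"
begin

abbreviation "c a b \<equiv> \<P>(\<omega> in M. B \<omega> = b \<bar> A \<omega> = a)"

lemma c_pos: "a \<in> pos_values M A \<Longrightarrow> b \<in> fib a \<Longrightarrow> 0 < c a b"
  by (simp add: cond_prob_def pos_values_def fib_def conj_commute)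

lemma sum_c: "a \<in> pos_values M A \<Longrightarrow> sum (c a) (fib a) = 1"
  using marginal[of "\<lambda>_. True" a]
  by (simp add: cond_prob_def sum_divide_distrib[symmetric] conj_commute pos_values_def)

text \<open>Conditional independence removes \<open>x\<close> from the weight of a cell within its
  stratum, so both treatment groups are scaled by the same factor.\<close>

lemma p'_eq: "a \<in> pos_values M A \<Longrightarrow> p' x a b = p x a * c a b"
proof -
  assume a: "a \<in> pos_values M A"
  then have "\<P>(\<omega> in M. X \<omega> = x \<and> B \<omega> = b \<bar> A \<omega> = a)
      = \<P>(\<omega> in M. X \<omega> = x \<bar> A \<omega> = a) * \<P>(\<omega> in M. B \<omega> = b \<bar> A \<omega> = a)"
    using ci unfolding discrete_cond_indep_def by blast
  with a have "\<P>(\<omega> in M. X \<omega> = x \<and> A \<omega> = a \<and> B \<omega> = b)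
      = \<P>(\<omega> in M. X \<omega> = x \<and> A \<omega> = a) * \<P>(\<omega> in M. A \<omega> = a \<and> B \<omega> = b) / \<P>(\<omega> in M. A \<omega> = a)"
    by (simp add: cond_prob_def field_simps conj_ac pos_values_def)
  then show ?thesis by (simp add: cond_prob_def conj_ac)
qed

text \<open>Cancel the positive \<open>p x a\<close> in \<open>qp_eq_sum\<close>. The coarse
  responses under both treatments become means for one and the same distribution, as the stratum
  inequalities require.\<close>

lemma q_eq_sum:
  assumes "a \<in> pos_values M A" "x \<in> {x1, x2}"
  shows "q z x a = (\<Sum>b\<in>fib a. c a b * q' z x a b)"
proof -
  have "q z x a * p x a = (\<Sum>b\<in>fib a. c a b * q' z x a b) * p x a"
    unfolding qp_eq_sum sum_distrib_right using p'_eq[OF assms(1), where x = x]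
    by (intro sum.cong) (simp_all only: mult_ac)
  then show ?thesis using p_pos[OF assms] by simp
qed

text \<open>Makes the squared sum in the variance of the indirect effect common to both sides; a
  square of a sum over strata could not be compared stratum by stratum.\<close>

lemma sum_qp_eq:
  "(\<Sum>v\<in>pos_values M (\<lambda>\<omega>. (A \<omega>, B \<omega>)).
      \<P>(\<omega> in M. Y \<omega> = y \<bar> X \<omega> = x1 \<and> (A \<omega>, B \<omega>) = v) * \<P>(\<omega> in M. (A \<omega>, B \<omega>) = v \<bar> X \<omega> = x2))
    = (\<Sum>a\<in>pos_values M A. q y x1 a * p x2 a)"
  unfolding sum_pair
proof (rule sum.cong[OF refl])
  fix a assume a: "a \<in> pos_values M A"
  show "(\<Sum>b\<in>fib a. q' y x1 a b * p' x2 a b) = q y x1 a * p x2 a"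
    unfolding q_eq_sum[OF a insertI1] sum_distrib_right using p'_eq[OF a, where x = x2]
    by (intro sum.cong) (simp_all only: mult_ac)
qed

context
  assumes large: "\<And>a. a \<in> pos_values M A \<Longrightarrow> 1 + real n2 * p x2 a \<le> real n1 * p x1 a"
begin

lemma avar_NIE_le_coarsen:
  "avar_NIE M X Y x1 x2 n1 n2 A y \<le> avar_NIE M X Y x1 x2 n1 n2 (\<lambda>\<omega>. (A \<omega>, B \<omega>)) y"
proof -
  have "(\<Sum>a\<in>pos_values M A. q y x1 a * (1 - q y x1 a) / (real n2)\<^sup>2 * ratio_approx n1 n2 (p x1 a) (p x2 a)
           - 2 * (q y x1 a * (1 - q y x1 a) * (p x2 a / real n1)) + (q y x1 a)\<^sup>2 * p x2 a / real n2)
      \<le> (\<Sum>a\<in>pos_values M A.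
           (\<Sum>b\<in>fib a. q' y x1 a b * (1 - q' y x1 a b) / (real n2)\<^sup>2 * ratio_approx n1 n2 (p' x1 a b) (p' x2 a b))
           - 2 * (\<Sum>b\<in>fib a. q' y x1 a b * (1 - q' y x1 a b) * (p' x2 a b / real n1))
           + (\<Sum>b\<in>fib a. (q' y x1 a b)\<^sup>2 * p' x2 a b) / real n2)"
  proof (rule sum_mono)
    fix a assume a: "a \<in> pos_values M A"
    show "q y x1 a * (1 - q y x1 a) / (real n2)\<^sup>2 * ratio_approx n1 n2 (p x1 a) (p x2 a)
           - 2 * (q y x1 a * (1 - q y x1 a) * (p x2 a / real n1)) + (q y x1 a)\<^sup>2 * p x2 a / real n2
      \<le> (\<Sum>b\<in>fib a. q' y x1 a b * (1 - q' y x1 a b) / (real n2)\<^sup>2 * ratio_approx n1 n2 (p' x1 a b) (p' x2 a b))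
           - 2 * (\<Sum>b\<in>fib a. q' y x1 a b * (1 - q' y x1 a b) * (p' x2 a b / real n1))
           + (\<Sum>b\<in>fib a. (q' y x1 a b)\<^sup>2 * p' x2 a b) / real n2"
      unfolding p'_eq[OF a]
      by (rule stratum_NIE_le[where c = "c a" and q = "q' y x1 a"])
        (intro finite_fib c_pos[OF a] sum_c[OF a] q'_bounds q_eq_sum[OF a] p_pos[OF a]
          less_imp_le[OF p_pos[OF a]] n large[OF a]; simp only: insert_iff simp_thms)+
  qed
  note le = this[unfolded sum.distrib sum_subtractf sum_distrib_left[where r = "2::real", symmetric]
      sum_divide_distrib[where r = "real n2", symmetric]]
  \<comment> \<open>\<open>r\<close> stands for the term in the response probability given
    \<open>x1\<close> alone, \<open>s\<close> for the square that \<open>sum_qp_eq\<close>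
    equates.\<close>
  have arith: "t - 2 * u + r + 1 / m * (v - s) \<le> t' - 2 * u' + r + 1 / m * (v' - s)"
    if "t - 2 * u + v / m \<le> t' - 2 * u' + v' / m" for t u r m v s t' u' v' :: real
    using that by (simp add: diff_divide_distrib)
  show ?thesis
    \<comment> \<open>The sum is rewritten by \<open>sum_qp_eq\<close> before
      \<open>sum_pair\<close> splits the remaining ones.\<close>
    unfolding avar_NIE_def Let_def sum_qp_eq mean_ratio_eq_ratio_approx
    unfolding sum_pair by (rule arith) (rule le)
qed

text \<open>The covariance condition concerns \<open>y1\<close> only. It carries over to
  \<open>y2\<close> because replacing both responses by their complements leaves a covariance
  unchanged.\<close>

lemma avar_NDE_le_coarsen:
  assumes eq: "NDE M X Y x1 x2 A y = NDE M X Y x1 x2 (\<lambda>\<omega>. (A \<omega>, B \<omega>)) y"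
    and Y: "y1 \<noteq> y2" "\<And>\<omega>. \<omega> \<in> space M \<Longrightarrow> Y \<omega> \<in> {y1, y2}" "y \<in> {y1, y2}"
    and cov: "\<And>a. a \<in> pos_values M A \<Longrightarrow> cov M X Y x1 x2 y1 B A a \<le> 0"
  shows "avar_NDE M X Y x1 x2 n1 n2 A y \<le> avar_NDE M X Y x1 x2 n1 n2 (\<lambda>\<omega>. (A \<omega>, B \<omega>)) y"
proof -
  have "(\<Sum>a\<in>pos_values M A. (q y x1 a - q y x2 a)\<^sup>2 * (p x2 a / real n2)
           + q y x1 a * (1 - q y x1 a) / (real n2)\<^sup>2 * ratio_approx n1 n2 (p x1 a) (p x2 a)
           + q y x2 a * (1 - q y x2 a) / real n2 * p x2 a)
      \<le> (\<Sum>a\<in>pos_values M A. (\<Sum>b\<in>fib a. (q' y x1 a b - q' y x2 a b)\<^sup>2 * (p' x2 a b / real n2))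
           + (\<Sum>b\<in>fib a. q' y x1 a b * (1 - q' y x1 a b) / (real n2)\<^sup>2 * ratio_approx n1 n2 (p' x1 a b) (p' x2 a b))
           + (\<Sum>b\<in>fib a. q' y x2 a b * (1 - q' y x2 a b) / real n2 * p' x2 a b))"
  proof (rule sum_mono)
    fix a assume a: "a \<in> pos_values M A"
    \<comment> \<open>Matches the index set in \<open>cov\<close> with the cells of the
      stratum.\<close>
    have "fib a = {b. 0 < c a b}"
      using a by (auto simp: fib_def cond_prob_def pos_values_def conj_commute zero_less_divide_iff)
    then have cov1: "(\<Sum>b\<in>fib a. c a b * (q' y1 x1 a b * q' y1 x2 a b)) \<le> q y1 x1 a * q y1 x2 a"
      using cov[OF a] by (simp add: cov_def mult_ac)
    \<comment> \<open>Needs a non-null cell: otherwise both conditional probabilities would be 0 by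
      convention.\<close>
    have compl: "q' y2 x a b = 1 - q' y1 x a b" if b: "b \<in> fib a" and x: "x \<in> {x1, x2}" for x b
    proof -
      let ?D = "\<P>(\<omega> in M. X \<omega> = x \<and> A \<omega> = a \<and> B \<omega> = b)"
      have "?D \<noteq> 0"
        using p'_pos[OF a b x] by (auto simp: cond_prob_def conj_ac)
      moreover have "?D = prob ({\<omega> \<in> space M. Y \<omega> = y1 \<and> X \<omega> = x \<and> A \<omega> = a \<and> B \<omega> = b}
          \<union> {\<omega> \<in> space M. Y \<omega> = y2 \<and> X \<omega> = x \<and> A \<omega> = a \<and> B \<omega> = b})"
        using Y(2) by (intro arg_cong[where f = prob]) blast
      moreover have "\<dots> = \<P>(\<omega> in M. Y \<omega> = y1 \<and> X \<omega> = x \<and> A \<omega> = a \<and> B \<omega> = b)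
          + \<P>(\<omega> in M. Y \<omega> = y2 \<and> X \<omega> = x \<and> A \<omega> = a \<and> B \<omega> = b)"
        using Y(1) by (intro finite_measure_Union) auto
      ultimately show ?thesis by (simp add: cond_prob_def field_simps)
    qed
    have q_compl: "q y2 x a = 1 - q y1 x a" if "x \<in> {x1, x2}" for x
    proof -
      have "q y2 x a = (\<Sum>b\<in>fib a. c a b - c a b * q' y1 x a b)"
        unfolding q_eq_sum[OF a that] using that
        by (intro sum.cong) (simp_all only: compl right_diff_distrib mult_1_right)
      then show ?thesis unfolding sum_subtractf sum_c[OF a] q_eq_sum[OF a that] by simp
    qed
    have "(\<Sum>b\<in>fib a. c a b * (q' y2 x1 a b * q' y2 x2 a b))
        = (\<Sum>b\<in>fib a. c a b - c a b * q' y1 x1 a b - c a b * q' y1 x2 a b + c a b * (q' y1 x1 a b * q' y1 x2 a b))"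
      by (intro sum.cong refl) (simp only: compl insert_iff simp_thms, simp add: algebra_simps)
    also have "\<dots> = 1 - q y1 x1 a - q y1 x2 a + (\<Sum>b\<in>fib a. c a b * (q' y1 x1 a b * q' y1 x2 a b))"
      unfolding sum.distrib sum_subtractf q_eq_sum[OF a insertI1] q_eq_sum[OF a insertI2[OF singletonI]]
      by (simp add: sum_c[OF a])
    also have "\<dots> \<le> (1 - q y1 x1 a) * (1 - q y1 x2 a)" using cov1 by (simp add: algebra_simps)
    finally have cov2: "(\<Sum>b\<in>fib a. c a b * (q' y2 x1 a b * q' y2 x2 a b)) \<le> q y2 x1 a * q y2 x2 a"
      by (simp only: q_compl insert_iff simp_thms)
    have cov: "(\<Sum>b\<in>fib a. c a b * (q' y x1 a b * q' y x2 a b)) \<le> q y x1 a * q y x2 a"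
      using Y(3) cov1 cov2 by blast
    show "(q y x1 a - q y x2 a)\<^sup>2 * (p x2 a / real n2)
           + q y x1 a * (1 - q y x1 a) / (real n2)\<^sup>2 * ratio_approx n1 n2 (p x1 a) (p x2 a)
           + q y x2 a * (1 - q y x2 a) / real n2 * p x2 a
      \<le> (\<Sum>b\<in>fib a. (q' y x1 a b - q' y x2 a b)\<^sup>2 * (p' x2 a b / real n2))
           + (\<Sum>b\<in>fib a. q' y x1 a b * (1 - q' y x1 a b) / (real n2)\<^sup>2 * ratio_approx n1 n2 (p' x1 a b) (p' x2 a b))
           + (\<Sum>b\<in>fib a. q' y x2 a b * (1 - q' y x2 a b) / real n2 * p' x2 a b)"
      unfolding p'_eq[OF a]
      by (rule stratum_NDE_le[where c = "c a" and ?q1.0 = "q' y x1 a" and ?q2.0 = "q' y x2 a"])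
        (intro cov finite_fib c_pos[OF a] sum_c[OF a] q'_bounds q_eq_sum[OF a] p_pos[OF a]
          less_imp_le[OF p_pos[OF a]] n large[OF a]; simp only: insert_iff simp_thms)+
  qed
  note le = this[unfolded sum.distrib]
  \<comment> \<open>\<open>k\<close> is the term in the squared direct effect, common to both sides
    by \<open>eq\<close>.\<close>
  have arith: "t - k + u + v \<le> t' - k + u' + v'" if "t + u + v \<le> t' + u' + v'"
    for t k u v t' u' v' :: real
    using that by simp
  show ?thesis
    unfolding avar_NDE_def Let_def eq mean_ratio_eq_ratio_approx
    unfolding sum_pair by (rule arith) (rule le)
qed

end

end

end

end

section \<open>Transfer from pairs to joint values of the union\<close>

theorem theorem4:
  fixes M :: "'a measure"
    and X :: "'a \<Rightarrow> 'x" and x1 x2 :: 'x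
    and Y :: "'a \<Rightarrow> 'y" and y1 y2 y :: 'y
    and F :: "'i \<Rightarrow> 'a \<Rightarrow> 'v"
    and S W Z R U T :: "'i set"
    and YpS YpW :: "'x \<Rightarrow> ('i \<Rightarrow> 'v) \<Rightarrow> 'a \<Rightarrow> 'y"
    and FpS FpW :: "'x \<Rightarrow> 'i \<Rightarrow> 'a \<Rightarrow> 'v"
    and n1 n2 :: nat
  assumes M: "prob_space M"
    and X: "simple_function M X" "x1 \<noteq> x2" "\<And>\<omega>. \<omega> \<in> space M \<Longrightarrow> X \<omega> \<in> {x1, x2}"
    and Y: "simple_function M Y" "y1 \<noteq> y2" "\<And>\<omega>. \<omega> \<in> space M \<Longrightarrow> Y \<omega> \<in> {y1, y2}"
    and y: "y \<in> {y1, y2}"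
    and fin: "finite S" "finite W" "finite Z" "finite R"
    and U: "U = S \<union> Z" "U \<noteq> {}"
    and T: "T = W \<union> R" "T \<noteq> {}"
    and F: "\<And>i. i \<in> U \<union> T \<Longrightarrow> simple_function M (F i)"
    and ident: "identification_conditions M X Y x1 x2 F S Z YpS FpS"
               "identification_conditions M X Y x1 x2 F W R YpW FpW"
    and pos: "positivity M X x1 x2 (joint F U)"
             "positivity M X x1 x2 (joint F T)"
             "positivity M X x1 x2 (joint F (U \<union> T))"
    and n: "n1 \<ge> 1" "n2 \<ge> 1"
  shows
    "(NDE M X Y x1 x2 (joint F U) y = NDE M X Y x1 x2 (joint F (U \<union> T)) y \<longrightarrow>
      NIE M X Y x1 x2 (joint F U) y = NIE M X Y x1 x2 (joint F (U \<union> T)) y \<longrightarrow>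
      discrete_cond_indep M Y (joint F T) (\<lambda>\<omega>. (X \<omega>, joint F U \<omega>)) \<longrightarrow>
        avar_NDE M X Y x1 x2 n1 n2 (joint F U) y
          \<le> avar_NDE M X Y x1 x2 n1 n2 (joint F (U \<union> T)) y \<and>
        avar_NIE M X Y x1 x2 n1 n2 (joint F U) y
          \<le> avar_NIE M X Y x1 x2 n1 n2 (joint F (U \<union> T)) y)
     \<and>
     (NDE M X Y x1 x2 (joint F T) y = NDE M X Y x1 x2 (joint F (U \<union> T)) y \<longrightarrow>
      NIE M X Y x1 x2 (joint F T) y = NIE M X Y x1 x2 (joint F (U \<union> T)) y \<longrightarrow>
      discrete_cond_indep M X (joint F U) (joint F T) \<longrightarrow>
        ((\<forall>t\<in>pos_values M (joint F T).
            1 + real n2 * \<P>(\<omega> in M. joint F T \<omega> = t \<bar> X \<omega> = x2)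
              \<le> real n1 * \<P>(\<omega> in M. joint F T \<omega> = t \<bar> X \<omega> = x1) \<and>
            cov M X Y x1 x2 y1 (joint F U) (joint F T) t \<le> 0) \<longrightarrow>
          avar_NDE M X Y x1 x2 n1 n2 (joint F T) y
            \<le> avar_NDE M X Y x1 x2 n1 n2 (joint F (U \<union> T)) y)
        \<and>
        ((\<forall>t\<in>pos_values M (joint F T).
            1 + real n2 * \<P>(\<omega> in M. joint F T \<omega> = t \<bar> X \<omega> = x2)
              \<le> real n1 * \<P>(\<omega> in M. joint F T \<omega> = t \<bar> X \<omega> = x1)) \<longrightarrow>
          avar_NIE M X Y x1 x2 n1 n2 (joint F T) y
            \<le> avar_NIE M X Y x1 x2 n1 n2 (joint F (U \<union> T)) y))"
proof -
  interpret prob_space M by (rule M)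
  \<comment> \<open>The coarse component comes first in a pair, so the two parts of the theorem use
    opposite orders: \<open>U\<close> is refined by \<open>T\<close> in (I), and \<open>T\<close> by
    \<open>U\<close> in (II).\<close>
  let ?V = "joint F (U \<union> T)" and ?UT = "\<lambda>\<omega>. (joint F U \<omega>, joint F T \<omega>)"
    and ?TU = "\<lambda>\<omega>. (joint F T \<omega>, joint F U \<omega>)"
  let ?h = "\<lambda>f. (restrict f U, restrict f T)" and ?k = "\<lambda>f. (restrict f T, restrict f U)"
  have image: "?V ` space M \<subseteq> extensional (U \<union> T)" by (auto simp: joint_def)
  have inj: "inj_on ?h (?V ` space M)" "inj_on ?k (?V ` space M)"
    using image inj_on_restrict_pair[of U T] inj_on_restrict_pair[of T U]
    by (auto simp: Un_commute intro: inj_on_subset)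
  have eq: "(\<lambda>\<omega>. ?h (?V \<omega>)) = ?UT" "(\<lambda>\<omega>. ?k (?V \<omega>)) = ?TU"
    by (auto simp: joint_def fun_eq_iff restrict_def)
  have simple: "simple_function M (joint F U)" "simple_function M (joint F T)"
    using F fin U T by (auto intro!: simple_function_joint)
  interpret UT: stratified M X Y "joint F U" "joint F T" x1 x2
    by unfold_locales
      (use X Y simple pos positivity_relabel[OF inj(1), of X x1 x2] in \<open>simp_all only: eq\<close>)
  interpret TU: stratified M X Y "joint F T" "joint F U" x1 x2
    by unfold_locales
      (use X Y simple pos positivity_relabel[OF inj(2), of X x1 x2] in \<open>simp_all only: eq\<close>)
  note rel = NDE_relabel[OF inj(1), of X Y x1 x2 y] avar_relabel[OF inj(1), of X Y x1 x2 n1 n2 y]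
    NDE_relabel[OF inj(2), of X Y x1 x2 y] avar_relabel[OF inj(2), of X Y x1 x2 n1 n2 y]
  note rel = rel[unfolded eq]
  show ?thesis
  proof (intro conjI impI)
    assume eq: "NDE M X Y x1 x2 (joint F U) y = NDE M X Y x1 x2 ?V y"
      and ci: "discrete_cond_indep M Y (joint F T) (\<lambda>\<omega>. (X \<omega>, joint F U \<omega>))"
    show "avar_NDE M X Y x1 x2 n1 n2 (joint F U) y \<le> avar_NDE M X Y x1 x2 n1 n2 ?V y"
      \<comment> \<open>The first fact still has the equality of effects as a premise. Once
        \<open>rel\<close> has replaced pairs by the union, \<open>eq\<close> discharges it.\<close>
      using UT.avar_NDE_le_refine[OF n ci, of y] eq unfolding rel by (rule meta_mp)
    show "avar_NIE M X Y x1 x2 n1 n2 (joint F U) y \<le> avar_NIE M X Y x1 x2 n1 n2 ?V y"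
      using UT.avar_NIE_le_refine[OF n ci, of y] unfolding rel .
  next
    assume eq: "NDE M X Y x1 x2 (joint F T) y = NDE M X Y x1 x2 ?V y"
      and ci: "discrete_cond_indep M X (joint F U) (joint F T)"
    {
      assume large: "\<forall>t\<in>pos_values M (joint F T).
          1 + real n2 * \<P>(\<omega> in M. joint F T \<omega> = t \<bar> X \<omega> = x2)
            \<le> real n1 * \<P>(\<omega> in M. joint F T \<omega> = t \<bar> X \<omega> = x1) \<and>
          cov M X Y x1 x2 y1 (joint F U) (joint F T) t \<le> 0"
      show "avar_NDE M X Y x1 x2 n1 n2 (joint F T) y \<le> avar_NDE M X Y x1 x2 n1 n2 ?V y"
        unfolding rel(5)[symmetric]
        by (rule TU.avar_NDE_le_coarsen[OF n ci _ _ Y(2,3) y]) (use eq rel large in auto)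
    next
      assume large: "\<forall>t\<in>pos_values M (joint F T).
          1 + real n2 * \<P>(\<omega> in M. joint F T \<omega> = t \<bar> X \<omega> = x2)
            \<le> real n1 * \<P>(\<omega> in M. joint F T \<omega> = t \<bar> X \<omega> = x1)"
      show "avar_NIE M X Y x1 x2 n1 n2 (joint F T) y \<le> avar_NIE M X Y x1 x2 n1 n2 ?V y"
        unfolding rel(6)[symmetric]
        by (rule TU.avar_NIE_le_coarsen[OF n ci]) (use large in auto)
    }
  qed
qed

end
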